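(* Every finitely presented group $G$ with Property (FA) admits a finite just-(FA) presentation. That is, for every such $G$ there exist a finite set $X$ and a finite set $R$ of relations over $X$ such that $\langle X \mid R \rangle$ is a presentation of $G$ and, for every $r \in R$, the group $\langle X \mid R \setminus \{r\} \rangle$ does not have Property (FA).
   Context: A group $G$ has Property (FA) if any action of $G$ on a tree has a fixed point. (By a theorem of Serre, a finitely generated group has Property (FA) if and only if it is neither a non-trivial amalgamated free product nor an HNN extension; here an amalgamated free product $A *_C B$ is non-trivial when $C \neq A$ and $C \neq B$.) A presentation $\langle X \mid R \rangle$ of a group with Property (FA) is called just-(FA) if, for every $r \in R$, the group $\langle X \mid R \setminus \{r\} \rangle$ does not have Property (FA). A presentation is finite if both $X$ and $R$ are finite. *)

theory Defs
  imports "HOL-Algebra.Group_Action"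
begin

section \<open>Free groups and presentations\<close>

text \<open>
  The letter \<open>(x, True)\<close> stands for the generator \<open>x\<close> and \<open>(x, False)\<close> for its formal inverse.
  The free group on \<open>S\<close> has the reduced words over \<open>S\<close> as its elements; the product of two reduced
  words is the reduced form of their concatenation.
\<close>

type_synonym 'x word = "('x \<times> bool) list"

definition letter_inv :: "'x \<times> bool \<Rightarrow> 'x \<times> bool"
  where "letter_inv a = (fst a, \<not> snd a)"

definition reduced :: "'x word \<Rightarrow> bool"
  where "reduced w \<longleftrightarrow> successively (\<lambda>a b. b \<noteq> letter_inv a) w"

fun add_letter :: "'x \<times> bool \<Rightarrow> 'x word \<Rightarrow> 'x word" where
  "add_letter a [] = [a]"
| "add_letter a (b # w) = (if b = letter_inv a then w else a # b # w)"

definition free_group :: "'x set \<Rightarrow> 'x word monoid" where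
  "free_group S =
    \<lparr>carrier = {w. set w \<subseteq> S \<times> UNIV \<and> reduced w}, monoid.mult = foldr add_letter, one = []\<rparr>"

definition normal_closure :: "('g, 'm) monoid_scheme \<Rightarrow> 'g set \<Rightarrow> 'g set"
  where "normal_closure G A = \<Inter>{N. N \<lhd> G \<and> A \<subseteq> N}"

definition presented_group :: "'x set \<Rightarrow> 'x word set \<Rightarrow> 'x word set monoid"
  where "presented_group S R = free_group S Mod normal_closure (free_group S) R"

definition presents :: "'x set \<Rightarrow> 'x word set \<Rightarrow> ('g, 'm) monoid_scheme \<Rightarrow> bool" where
  "presents S R G \<longleftrightarrow> R \<subseteq> carrier (free_group S) \<and> presented_group S R \<cong> G"

text \<open>Any finite set of generators can be renamed to a finite set of natural numbers.\<close>

definition finitely_presented :: "('g, 'm) monoid_scheme \<Rightarrow> bool" where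
  "finitely_presented G \<longleftrightarrow> (\<exists>(S :: nat set) R. finite S \<and> finite R \<and> presents S R G)"

lemma letter_inv_inv [simp]: "letter_inv (letter_inv a) = a"
  by (simp add: letter_inv_def)

lemma reduced_Nil [simp]: "reduced []"
  by (simp add: reduced_def)

lemma reduced_Cons: "reduced (a # w) \<longleftrightarrow> (w = [] \<or> hd w \<noteq> letter_inv a) \<and> reduced w"
  by (auto simp: reduced_def successively_Cons)

lemma reduced_add_letter: "reduced w \<Longrightarrow> reduced (add_letter a w)"
  by (cases w) (auto simp: reduced_Cons)

lemma add_letter_inv: "reduced w \<Longrightarrow> add_letter a (add_letter (letter_inv a) w) = w"
  by (cases w rule: remdups_adj.cases) (auto simp: reduced_Cons)

lemma reduced_foldr: "reduced w \<Longrightarrow> reduced (foldr add_letter u w)"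
  by (induction u) (auto intro: reduced_add_letter)

lemma foldr_add_letter:
  assumes "reduced w"
  shows "foldr add_letter (add_letter a u) w = add_letter a (foldr add_letter u w)"
  using assms by (cases u) (auto simp: add_letter_inv reduced_foldr)

lemma foldr_add_letter_assoc:
  assumes "reduced w"
  shows "foldr add_letter (foldr add_letter u v) w = foldr add_letter u (foldr add_letter v w)"
  using assms by (induction u) (auto simp: foldr_add_letter)

lemma foldr_add_letter_Nil: "reduced u \<Longrightarrow> foldr add_letter u [] = u"
proof (induction u)
  case (Cons a u)
  then show ?case by (cases u) (auto simp: reduced_Cons)
qed simp

lemma set_add_letter: "set (add_letter a w) \<subseteq> insert a (set w)"
  by (cases w) auto

lemma set_foldr_add_letter: "set (foldr add_letter u w) \<subseteq> set u \<union> set w"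
  by (induction u) (use set_add_letter in fastforce)+

lemma foldr_rev_inv: "foldr add_letter (rev (map letter_inv u)) u = []"
  by (induction u) auto

lemma reduced_rev_inv: "reduced u \<Longrightarrow> reduced (rev (map letter_inv u))"
  unfolding reduced_def successively_rev successively_map
  by (erule successively_mono) (metis letter_inv_inv)

lemma group_free_group: "group (free_group S)"
proof (rule groupI)
  fix u assume u: "u \<in> carrier (free_group S)"
  have "rev (map letter_inv u) \<in> carrier (free_group S)"
    using u by (auto simp: free_group_def reduced_rev_inv letter_inv_def)
  moreover have "rev (map letter_inv u) \<otimes>\<^bsub>free_group S\<^esub> u = \<one>\<^bsub>free_group S\<^esub>"
    by (simp add: free_group_def foldr_rev_inv)
  ultimately show "\<exists>v\<in>carrier (free_group S). v \<otimes>\<^bsub>free_group S\<^esub> u = \<one>\<^bsub>free_group S\<^esub>"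
    by blast
next
  fix u v assume "u \<in> carrier (free_group S)" "v \<in> carrier (free_group S)"
  then show "u \<otimes>\<^bsub>free_group S\<^esub> v \<in> carrier (free_group S)"
    using set_foldr_add_letter[of u v] by (auto simp: free_group_def reduced_foldr)
qed (auto simp: free_group_def foldr_add_letter_assoc)

lemma normal_closure_normal:
  assumes "group G" "A \<subseteq> carrier G"
  shows "normal_closure G A \<lhd> G"
proof -
  interpret group G by fact
  have "carrier G \<lhd> G"
    by (rule normal_invI) (auto simp: subgroup_self)
  then have ne: "{N. N \<lhd> G \<and> A \<subseteq> N} \<noteq> {}"
    using assms(2) by blast
  show ?thesis
    unfolding normal_closure_def
  proof (rule normal_invI)
    show "subgroup (\<Inter>{N. N \<lhd> G \<and> A \<subseteq> N}) G"
      using ne by (intro subgroups_Inter) (auto simp: normal_imp_subgroup)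
  qed (auto intro: normal.inv_op_closed2)
qed

lemma group_presented_group:
  "R \<subseteq> carrier (free_group S) \<Longrightarrow> group (presented_group S R)"
  unfolding presented_group_def
  by (intro normal.factorgroup_is_group normal_closure_normal group_free_group)


section \<open>Trees and Property (FA)\<close>

text \<open>
  A tree is a nonempty connected simple graph without cycles, of any cardinality. An undirected edge
  between \<open>x\<close> and \<open>y\<close> is represented by the two pairs \<open>(x, y)\<close> and \<open>(y, x)\<close>.
\<close>

definition cycle :: "'v rel \<Rightarrow> 'v list \<Rightarrow> bool" where
  "cycle E c \<longleftrightarrow> length c \<ge> 3 \<and> distinct c \<and> successively (\<lambda>x y. (x, y) \<in> E) c \<and> (last c, hd c) \<in> E"

definition tree :: "'v set \<Rightarrow> 'v rel \<Rightarrow> bool" where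
  "tree V E \<longleftrightarrow> V \<noteq> {} \<and> E \<subseteq> V \<times> V \<and> sym E \<and> irrefl E \<and>
     (\<forall>x\<in>V. \<forall>y\<in>V. (x, y) \<in> E\<^sup>*) \<and> (\<nexists>c. cycle E c)"

text \<open>As usual in Bass--Serre theory, groups act on trees by automorphisms and without inversions.\<close>

definition tree_action ::
    "('g, 'm) monoid_scheme \<Rightarrow> 'v set \<Rightarrow> 'v rel \<Rightarrow> ('g \<Rightarrow> 'v \<Rightarrow> 'v) \<Rightarrow> bool" where
  "tree_action G V E \<phi> \<longleftrightarrow> tree V E \<and> group_action G V \<phi> \<and>
     (\<forall>g\<in>carrier G. \<forall>(x, y)\<in>E. (\<phi> g x, \<phi> g y) \<in> E \<and> \<not> (\<phi> g x = y \<and> \<phi> g y = x))"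

definition has_fixed_point ::
    "('g, 'm) monoid_scheme \<Rightarrow> 'v set \<Rightarrow> ('g \<Rightarrow> 'v \<Rightarrow> 'v) \<Rightarrow> bool" where
  "has_fixed_point G V \<phi> \<longleftrightarrow> (\<exists>v\<in>V. \<forall>g\<in>carrier G. \<phi> g v = v)"

text \<open>
  A definition cannot quantify over all types of vertices. Lists over the type of the group elements
  are enough vertices: by the lemma \<open>property_FA_fixed_point\<close> below, a group with the following
  property has a fixed point in each of its actions on a tree with vertices of any type.
\<close>

definition property_FA :: "('g, 'm) monoid_scheme \<Rightarrow> bool" where
  "property_FA G \<longleftrightarrow>
     (\<forall>(V :: 'g list set) E \<phi>. tree_action G V E \<phi> \<longrightarrow> has_fixed_point G V \<phi>)"

definition just_FA :: "'x set \<Rightarrow> 'x word set \<Rightarrow> bool" where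
  "just_FA S R \<longleftrightarrow> R \<subseteq> carrier (free_group S) \<and> property_FA (presented_group S R) \<and>
     (\<forall>r\<in>R. \<not> property_FA (presented_group S (R - {r})))"

lemma group_actionI:
  assumes "group G"
    and cl: "\<And>g x. g \<in> carrier G \<Longrightarrow> x \<in> V \<Longrightarrow> \<phi> g x \<in> V"
    and one: "\<And>x. x \<in> V \<Longrightarrow> \<phi> \<one>\<^bsub>G\<^esub> x = x"
    and mult: "\<And>g h x. g \<in> carrier G \<Longrightarrow> h \<in> carrier G \<Longrightarrow> x \<in> V \<Longrightarrow>
      \<phi> (g \<otimes>\<^bsub>G\<^esub> h) x = \<phi> g (\<phi> h x)"
  shows "group_action G V (\<lambda>g. restrict (\<phi> g) V)"
proof -
  interpret group G by fact
  have "bij_betw (restrict (\<phi> g) V) V V" if g: "g \<in> carrier G" for g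
  proof (rule bij_betw_byWitness[where f' = "\<phi> (inv\<^bsub>G\<^esub> g)"])
    show "\<forall>x\<in>V. \<phi> (inv\<^bsub>G\<^esub> g) (restrict (\<phi> g) V x) = x"
      using g mult[of "inv\<^bsub>G\<^esub> g" g] one by simp
    show "\<forall>x\<in>V. restrict (\<phi> g) V (\<phi> (inv\<^bsub>G\<^esub> g) x) = x"
      using g mult[of g "inv\<^bsub>G\<^esub> g"] one cl[of "inv\<^bsub>G\<^esub> g"] by simp
  qed (use g cl in auto)
  then have B: "restrict (\<phi> g) V \<in> Bij V" if "g \<in> carrier G" for g
    using that by (simp add: Bij_def)
  have "(\<lambda>g. restrict (\<phi> g) V) \<in> hom G (BijGroup V)"
    using B by (auto simp: hom_def BijGroup_def compose_def mult cl fun_eq_iff restrict_def)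
  then show ?thesis
    by (simp add: group_action_def group_hom_def group_hom_axioms_def group_BijGroup assms(1))
qed

lemma property_FA_fixed_point:
  fixes G :: "('g, 'm) monoid_scheme" and V :: "'v set"
  assumes FA: "property_FA G" and act: "tree_action G V E \<phi>"
  shows "has_fixed_point G V \<phi>"
proof -
  have T: "tree V E" and A: "group_action G V \<phi>"
    and pres: "\<And>g x y. g \<in> carrier G \<Longrightarrow> (x, y) \<in> E \<Longrightarrow> (\<phi> g x, \<phi> g y) \<in> E"
    and noinv: "\<And>g x y. g \<in> carrier G \<Longrightarrow> (x, y) \<in> E \<Longrightarrow> \<phi> g x = y \<Longrightarrow> \<phi> g y \<noteq> x"
    using act by (auto simp: tree_action_def)
  interpret group_action G V \<phi> by fact
  interpret group G using group_hom by (simp add: group_hom_def)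
  have cl: "\<phi> g x \<in> V" if "g \<in> carrier G" "x \<in> V" for g x
    using that element_image by blast
  have one: "\<phi> \<one>\<^bsub>G\<^esub> x = x" if "x \<in> V" for x
    using that id_eq_one by (metis restrict_apply')
  obtain v0 where v0: "v0 \<in> V" using T by (auto simp: tree_def)
  \<comment> \<open>walks from \<open>v0\<close> to the points of its orbit span a small invariant subtree \<open>W\<close>\<close>
  have "\<exists>n p. p 0 = v0 \<and> p n = \<phi> g v0 \<and> (\<forall>i<n. (p i, p (Suc i)) \<in> E)" if "g \<in> carrier G" for g
  proof -
    have "(v0, \<phi> g v0) \<in> E\<^sup>*" using T v0 cl that by (auto simp: tree_def)
    then obtain n where "(v0, \<phi> g v0) \<in> E ^^ n" using rtrancl_power by blast
    then show ?thesis by (auto simp: relpow_fun_conv)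
  qed
  then obtain n p where p: "\<And>g. g \<in> carrier G \<Longrightarrow> p g 0 = v0"
      "\<And>g. g \<in> carrier G \<Longrightarrow> p g (n g) = \<phi> g v0"
      "\<And>g i. g \<in> carrier G \<Longrightarrow> i < n g \<Longrightarrow> (p g i, p g (Suc i)) \<in> E"
    by metis
  have pV: "p g i \<in> V" if "g \<in> carrier G" "i \<le> n g" for g i
    using that p[of g] v0 T by (cases i) (auto simp: tree_def Suc_le_eq)
  define W where "W = {\<phi> h (p g i) | h g i. h \<in> carrier G \<and> g \<in> carrier G \<and> i \<le> n g}"
  define F where "F = E \<inter> W \<times> W"
  have WV: "W \<subseteq> V" using cl pV by (auto simp: W_def)
  have Wcl: "\<phi> g x \<in> W" if "g \<in> carrier G" "x \<in> W" for g x
  proof -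
    obtain h k i where *: "x = \<phi> h (p k i)" "h \<in> carrier G" "k \<in> carrier G" "i \<le> n k"
      using \<open>x \<in> W\<close> by (auto simp: W_def)
    then have "\<phi> g x = \<phi> (g \<otimes>\<^bsub>G\<^esub> h) (p k i)"
      using composition_rule[of "p k i" g h] pV that by simp
    then show ?thesis using * that by (auto simp: W_def)
  qed
  have orb: "\<phi> h v0 \<in> W" if "h \<in> carrier G" for h
    using that p(1)[of "\<one>\<^bsub>G\<^esub>"] by (force simp: W_def)
  have walk: "(\<phi> h v0, \<phi> h (p g i)) \<in> F\<^sup>*" if "h \<in> carrier G" "g \<in> carrier G" "i \<le> n g" for h g i
    using that(3)
  proof (induction i)
    case (Suc i)
    then have "(\<phi> h (p g i), \<phi> h (p g (Suc i))) \<in> F"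
      using that p(3)[of g i] pres by (auto simp: F_def W_def intro: Suc_leD)
    moreover have "(\<phi> h v0, \<phi> h (p g i)) \<in> F\<^sup>*" using Suc by simp
    ultimately show ?case by (rule rtrancl_into_rtrancl[rotated])
  qed (simp add: p that)
  have "sym F" using T by (auto simp: tree_def F_def sym_def)
  have base: "(v0, x) \<in> F\<^sup>*" if x: "x \<in> W" for x
  proof -
    obtain h g i where *: "x = \<phi> h (p g i)" "h \<in> carrier G" "g \<in> carrier G" "i \<le> n g"
      using x unfolding W_def by blast
    have "(v0, \<phi> h v0) \<in> F\<^sup>*"
      using walk[of "\<one>\<^bsub>G\<^esub>" h "n h"] * p(2)[of h] one v0 cl by simp
    also have "(\<phi> h v0, x) \<in> F\<^sup>*" using walk * by simp
    finally show ?thesis .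
  qed
  have conn: "(x, y) \<in> F\<^sup>*" if "x \<in> W" "y \<in> W" for x y
    using base[OF that(1)] base[OF that(2)] \<open>sym F\<close> by (meson rtrancl_trans sym_rtrancl symE)
  \<comment> \<open>\<open>W\<close> can be coded by lists over the group\<close>
  define dec where "dec l = \<phi> (hd l) (p (hd (tl l)) (length (tl (tl l))))" for l :: "'g list"
  have "x \<in> range dec" if x: "x \<in> W" for x
  proof -
    obtain h g i where "x = \<phi> h (p g i)" using x by (auto simp: W_def)
    then have "x = dec (h # g # replicate i g)" by (simp add: dec_def)
    then show ?thesis by blast
  qed
  then have Wdec: "W \<subseteq> range dec" by blast
  define c where "c = inv_into UNIV dec"
  have dc: "dec (c x) = x" if "x \<in> W" for x
    using that Wdec by (auto simp: c_def f_inv_into_f)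
  define V' where "V' = c ` W"
  define E' where "E' = map_prod c c ` F"
  define \<psi> where "\<psi> g l = c (\<phi> g (dec l))" for g l
  have dW: "dec l \<in> W" if "l \<in> V'" for l using that dc by (auto simp: V'_def)
  have dF: "(dec k, dec l) \<in> F" if "(k, l) \<in> E'" for k l
    using that dc by (auto simp: E'_def F_def)
  have act': "group_action G V' (\<lambda>g. restrict (\<psi> g) V')"
  proof (rule group_actionI)
    show "group G" ..
    fix g l assume "g \<in> carrier G" "l \<in> V'"
    then show "\<psi> g l \<in> V'" using Wcl dW by (auto simp: \<psi>_def V'_def)
  next
    fix l assume l: "l \<in> V'"
    then show "\<psi> \<one>\<^bsub>G\<^esub> l = l"
      using dW[OF l] dc WV one by (auto simp: \<psi>_def V'_def)
  next
    fix g h l assume *: "g \<in> carrier G" "h \<in> carrier G" "l \<in> V'"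
    then have "dec l \<in> W" "dec l \<in> V" using dW WV by auto
    with * show "\<psi> (g \<otimes>\<^bsub>G\<^esub> h) l = \<psi> g (\<psi> h l)"
      using composition_rule dc Wcl by (simp add: \<psi>_def)
  qed
  have "tree V' E'"
    unfolding tree_def
  proof (intro conjI ballI)
    show "V' \<noteq> {}" using orb[of "\<one>\<^bsub>G\<^esub>"] by (auto simp: V'_def)
    show "E' \<subseteq> V' \<times> V'" by (auto simp: E'_def V'_def F_def)
    show "sym E'" using \<open>sym F\<close> by (fastforce simp: sym_def E'_def)
    show "irrefl E'"
      using dF T by (fastforce simp: irrefl_def tree_def F_def)
    show "(k, l) \<in> E'\<^sup>*" if "k \<in> V'" "l \<in> V'" for k l
    proof -
      have "(c x, c y) \<in> E'\<^sup>*" if "(x, y) \<in> F\<^sup>*" for x y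
        using that
      proof (induction rule: rtrancl_induct)
        case (step y z)
        then have "(c y, c z) \<in> E'" unfolding E'_def by (blast intro: map_prod_imageI)
        with step.IH show ?case by (rule rtrancl_into_rtrancl)
      qed simp
      then show ?thesis using that conn by (auto simp: V'_def)
    qed
    show "\<nexists>q. cycle E' q"
    proof
      assume "\<exists>q. cycle E' q"
      then obtain q where q: "length q \<ge> 3" "distinct q" "successively (\<lambda>x y. (x, y) \<in> E') q"
        "(last q, hd q) \<in> E'" by (auto simp: cycle_def)
      have E'V': "k \<in> V'" "l \<in> V'" if "(k, l) \<in> E'" for k l
        using that by (auto simp: E'_def V'_def F_def)
      then have "last q \<in> V'" using q(4) by blast
      with q(3) have "set q \<subseteq> V'"
        by (induction q rule: induct_list012) (use E'V' in auto)
      then have "inj_on dec (set q)"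
        using dc by (auto simp: V'_def inj_on_def subset_iff image_iff) metis
      then have "distinct (map dec q)" using q by (simp add: distinct_map)
      moreover have "successively (\<lambda>x y. (x, y) \<in> E) (map dec q)"
        unfolding successively_map using q(3)
        by (rule successively_mono) (use dF in \<open>auto simp: F_def\<close>)
      moreover have "(last (map dec q), hd (map dec q)) \<in> E"
        using dF[OF q(4)] q(1) by (cases "q = []") (auto simp: F_def last_map hd_map)
      ultimately have "cycle E (map dec q)" using q(1) by (simp add: cycle_def)
      then show False using T by (auto simp: tree_def)
    qed
  qed
  moreover have "\<forall>g\<in>carrier G. \<forall>(k, l)\<in>E'. (restrict (\<psi> g) V' k, restrict (\<psi> g) V' l) \<in> E' \<and>
      \<not> (restrict (\<psi> g) V' k = l \<and> restrict (\<psi> g) V' l = k)"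
  proof (intro ballI, clarify)
    fix g k l assume g: "g \<in> carrier G" and kl: "(k, l) \<in> E'"
    have V': "k \<in> V'" "l \<in> V'" using kl by (auto simp: E'_def V'_def F_def)
    have e: "(dec k, dec l) \<in> E" "dec k \<in> W" "dec l \<in> W" using dF[OF kl] by (auto simp: F_def)
    then have f: "(\<phi> g (dec k), \<phi> g (dec l)) \<in> F" using pres g Wcl by (auto simp: F_def)
    then have "(\<psi> g k, \<psi> g l) \<in> E'" by (auto simp: \<psi>_def E'_def)
    moreover have "\<not> (\<psi> g k = l \<and> \<psi> g l = k)"
      using noinv[OF g e(1)] dc Wcl[OF g e(2)] Wcl[OF g e(3)] unfolding \<psi>_def by metis
    ultimately show "(restrict (\<psi> g) V' k, restrict (\<psi> g) V' l) \<in> E' \<and>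
      \<not> (restrict (\<psi> g) V' k = l \<and> restrict (\<psi> g) V' l = k)" using V' by simp
  qed
  ultimately have "tree_action G V' E' (\<lambda>g. restrict (\<psi> g) V')"
    using act' by (simp add: tree_action_def)
  then have "has_fixed_point G V' (\<lambda>g. restrict (\<psi> g) V')"
    using FA by (simp add: property_FA_def)
  then obtain l where l: "l \<in> V'" "\<And>g. g \<in> carrier G \<Longrightarrow> restrict (\<psi> g) V' l = l"
    by (auto simp: has_fixed_point_def)
  have "\<phi> g (dec l) = dec l" if g: "g \<in> carrier G" for g
  proof -
    have "dec (\<psi> g l) = dec l" using l g by simp
    then show ?thesis using dc[OF Wcl[OF g dW[OF l(1)]]] by (simp add: \<psi>_def)
  qed
  then show ?thesis using dW[OF l(1)] WV by (auto simp: has_fixed_point_def)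
qed

end

theory Submission
  imports Defs
begin

text \<open>
  Let \<open>\<langle>S | R\<rangle>\<close> be a finite presentation of the group \<open>G\<close> with Property (FA), and suppose that \<open>G\<close>
  is nontrivial. Deleting relators one after the other until none can be spared without losing
  Property (FA) may change the group. Instead, every relator \<open>r\<close> is replaced by a new generator
  \<open>t\<^sub>r\<close> and the two relations \<open>t\<^sub>r\<^sup>2 = r\<close> and \<open>t\<^sub>r\<^sup>3 = r\<close>. Together they say
  \<open>t\<^sub>r = 1\<close> and \<open>r = 1\<close>, so the new presentation still presents \<open>G\<close>
  (\<open>root_adjunction.presented_group_iso\<close>).

  Now omit one of the relations, say \<open>t\<^sub>r\<^sup>i = r\<close>, and let \<open>j\<close> be the other exponent. Send each
  generator in \<open>S\<close> to its image in \<open>G\<close>, send \<open>t\<^sub>r\<close> to a generator of a cyclic group of order \<open>j\<close>,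
  and send the other new generators to \<open>1\<close>. All remaining relations hold, because every \<open>r\<close> is
  already trivial in \<open>G\<close>; so the group maps onto the free product \<open>G * \<int>/j\<close>. Both factors are
  nontrivial, hence this free product acts without a fixed point on its Bass--Serre tree
  (\<open>root_adjunction.not_property_FA_remove\<close>). The group itself is an amalgamated product
  of \<open>\<langle>S | R - {r}\<rangle>\<close> with a cyclic group, in which \<open>r\<close> is identified with the \<open>j\<close>-th power of a
  generator; passing to the quotient in which \<open>r\<close> dies replaces it by a free product, whose tree
  can be written down as a tree of words (\<open>cyclic_free_product\<close>).

  If \<open>G\<close> is trivial, then \<open>G * \<int>/j\<close> does have Property (FA); but then the empty presentation is
  vacuously just-(FA).
\<close>

section \<open>Evaluating words and mapping out of presented groups\<close>

definition word_value :: "('g, 'm) monoid_scheme \<Rightarrow> ('x \<Rightarrow> 'g) \<Rightarrow> 'x word \<Rightarrow> 'g" where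
  "word_value K f w =
     foldr (\<lambda>a y. (if snd a then f (fst a) else inv\<^bsub>K\<^esub> f (fst a)) \<otimes>\<^bsub>K\<^esub> y) w \<one>\<^bsub>K\<^esub>"

lemma word_value_Nil [simp]: "word_value K f [] = \<one>\<^bsub>K\<^esub>"
  by (simp add: word_value_def)

lemma word_value_Cons [simp]:
  "word_value K f (a # w) =
     (if snd a then f (fst a) else inv\<^bsub>K\<^esub> f (fst a)) \<otimes>\<^bsub>K\<^esub> word_value K f w"
  by (simp add: word_value_def)

text \<open>
  Stated for a subgroup \<open>H\<close> so that a property of the images of the generators, such as being a
  graph automorphism, passes to the images of all words.\<close>

lemma word_value_in_subgroup:
  assumes "group K" "subgroup H K" "f \<in> S \<rightarrow> H" "set w \<subseteq> S \<times> UNIV"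
  shows "word_value K f w \<in> H"
  using assms(4)
proof (induction w)
  case (Cons a w)
  then show ?case using assms(2,3)
    by (auto simp: Pi_iff mem_Times_iff intro!: subgroup.m_closed subgroup.m_inv_closed)
qed (use assms(2) in \<open>simp add: subgroup.one_closed\<close>)

lemma word_value_closed:
  assumes "group K" "f \<in> S \<rightarrow> carrier K" "set w \<subseteq> S \<times> UNIV"
  shows "word_value K f w \<in> carrier K"
  using assms word_value_in_subgroup group.subgroup_self by metis

text \<open>
  A cancellation in the free group deletes a letter and its inverse, whose values cancel as well;
  this is what makes evaluation of words a homomorphism.\<close>

lemma word_value_add_letter:
  assumes "group K" "f \<in> S \<rightarrow> carrier K" "a \<in> S \<times> UNIV" "set w \<subseteq> S \<times> UNIV"
  shows "word_value K f (add_letter a w) = word_value K f (a # w)"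
proof (cases w)
  case (Cons b u)
  interpret group K by fact
  have "word_value K f u \<in> carrier K"
    using assms Cons by (intro word_value_closed) auto
  moreover have "f (fst a) \<in> carrier K" using assms by auto
  ultimately show ?thesis
    by (auto simp: Cons letter_inv_def r_inv l_inv simp flip: m_assoc)
qed simp

lemma word_value_mult:
  assumes K: "group K" and f: "f \<in> S \<rightarrow> carrier K"
    and u: "set u \<subseteq> S \<times> UNIV" and v: "set v \<subseteq> S \<times> UNIV"
  shows "word_value K f (foldr add_letter u v) = word_value K f u \<otimes>\<^bsub>K\<^esub> word_value K f v"
  using u
proof (induction u)
  case Nil
  then show ?case using word_value_closed[OF K f v] K by (simp add: group.is_monoid monoid.l_one)
next
  case (Cons a u)
  interpret group K by fact
  have s: "set (foldr add_letter u v) \<subseteq> S \<times> UNIV"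
    using Cons.prems v set_foldr_add_letter[of u v] by auto
  have "word_value K f u \<in> carrier K" "word_value K f v \<in> carrier K" "f (fst a) \<in> carrier K"
    using word_value_closed[OF K f] Cons.prems v f by auto
  then show ?case
    using word_value_add_letter[OF K f _ s] Cons by (simp add: m_assoc)
qed

lemma word_value_hom:
  assumes "group K" "f \<in> S \<rightarrow> carrier K"
  shows "word_value K f \<in> hom (free_group S) K"
  using assms word_value_closed[OF assms] word_value_mult[OF assms]
  by (auto simp: hom_def free_group_def)

lemma hom_word_value:
  assumes "group K" "group L" "h \<in> hom K L" "f \<in> S \<rightarrow> carrier K" "set w \<subseteq> S \<times> UNIV"
  shows "h (word_value K f w) = word_value L (h \<circ> f) w"
  using assms(5)
proof (induction w)
  case Nil
  then show ?case using assms by (simp add: hom_one)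
next
  case (Cons a w)
  have "word_value K f w \<in> carrier K" "f (fst a) \<in> carrier K"
    using word_value_closed[of K f S w] assms Cons.prems by auto
  moreover have "group_hom K L h"
    using assms by (simp add: group_hom_def group_hom_axioms_def)
  ultimately show ?case
    using Cons assms(1) by (simp add: group_hom.hom_mult group_hom.hom_inv)
qed

lemma word_value_cong:
  assumes "\<And>x. x \<in> S \<Longrightarrow> f x = g x" "set w \<subseteq> S \<times> UNIV"
  shows "word_value K f w = word_value K g w"
  using assms(2) by (induction w) (auto simp: assms(1))

lemma word_value_one:
  assumes "group K" "\<And>x. x \<in> S \<Longrightarrow> f x = \<one>\<^bsub>K\<^esub>" "set w \<subseteq> S \<times> UNIV"
  shows "word_value K f w = \<one>\<^bsub>K\<^esub>"
proof -
  interpret group K by fact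
  show ?thesis using assms(3) by (induction w) (auto simp: assms(2))
qed

lemma inv_free_group_letter:
  assumes "x \<in> S"
  shows "inv\<^bsub>free_group S\<^esub> [(x, True)] = [(x, False)]"
proof -
  interpret group "free_group S" by (rule group_free_group)
  show ?thesis
    by (rule inv_equality) (use assms in \<open>auto simp: free_group_def letter_inv_def reduced_def\<close>)
qed

lemma word_value_free_group:
  assumes "w \<in> carrier (free_group S)"
  shows "word_value (free_group S) (\<lambda>x. [(x, True)]) w = w"
proof -
  have "word_value (free_group S) (\<lambda>x. [(x, True)]) w = w"
    if "set w \<subseteq> S \<times> UNIV" "reduced w" for w
    using that
  proof (induction w)
    case (Cons a w)
    then have "word_value (free_group S) (\<lambda>x. [(x, True)]) w = w"
      by (auto simp: reduced_Cons)
    moreover have "(if snd a then [(fst a, True)] else inv\<^bsub>free_group S\<^esub> [(fst a, True)]) = [a]"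
      using Cons.prems by (cases a) (auto simp: inv_free_group_letter)
    moreover have "add_letter a w = a # w"
      using Cons.prems by (cases w) (auto simp: reduced_Cons)
    moreover have "[a] \<otimes>\<^bsub>free_group S\<^esub> w = add_letter a w"
      by (simp add: free_group_def)
    ultimately show ?case by simp
  qed (simp add: free_group_def)
  then show ?thesis using assms by (auto simp: free_group_def)
qed

definition generator :: "'x set \<Rightarrow> 'x word set \<Rightarrow> 'x \<Rightarrow> 'x word set" where
  "generator S R x = normal_closure (free_group S) R #>\<^bsub>free_group S\<^esub> [(x, True)]"

context
  fixes S :: "'x set" and R :: "'x word set"
  assumes R: "R \<subseteq> carrier (free_group S)"
begin

lemma normal_closure_relators: "normal_closure (free_group S) R \<lhd> free_group S"
  by (intro normal_closure_normal group_free_group R)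

lemma quotient_hom:
  "(\<lambda>w. normal_closure (free_group S) R #>\<^bsub>free_group S\<^esub> w) \<in> hom (free_group S) (presented_group S R)"
  unfolding presented_group_def
  by (rule normal.r_coset_hom_Mod[OF normal_closure_relators])

lemma letter_closed: "(\<lambda>x. [(x, True)]) \<in> S \<rightarrow> carrier (free_group S)"
  by (auto simp: free_group_def reduced_def)

lemma generator_closed: "generator S R \<in> S \<rightarrow> carrier (presented_group S R)"
  using letter_closed quotient_hom by (auto simp: generator_def hom_def)

lemma word_value_generator:
  assumes w: "w \<in> carrier (free_group S)"
  shows "word_value (presented_group S R) (generator S R) w =
    normal_closure (free_group S) R #>\<^bsub>free_group S\<^esub> w"
proof -
  have s: "set w \<subseteq> S \<times> UNIV" using w by (simp add: free_group_def)
  show ?thesis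
    using hom_word_value[OF group_free_group group_presented_group[OF R] quotient_hom letter_closed s]
      word_value_free_group[OF w]
    by (simp add: generator_def[abs_def] comp_def)
qed

lemma presented_group_word:
  assumes "p \<in> carrier (presented_group S R)"
  obtains w where "w \<in> carrier (free_group S)" "set w \<subseteq> S \<times> UNIV"
    "p = word_value (presented_group S R) (generator S R) w"
proof -
  obtain w where w: "w \<in> carrier (free_group S)"
    "p = normal_closure (free_group S) R #>\<^bsub>free_group S\<^esub> w"
    using assms by (auto simp: presented_group_def FactGroup_def RCOSETS_def)
  show thesis
    by (rule that[of w]) (use w word_value_generator in \<open>auto simp: free_group_def\<close>)
qed

lemma word_value_relator:
  assumes "r \<in> R"
  shows "word_value (presented_group S R) (generator S R) r = \<one>\<^bsub>presented_group S R\<^esub>"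
proof -
  have "r \<in> normal_closure (free_group S) R" using assms by (auto simp: normal_closure_def)
  moreover have "subgroup (normal_closure (free_group S) R) (free_group S)"
    using normal_closure_relators by (rule normal_imp_subgroup)
  ultimately have "normal_closure (free_group S) R #>\<^bsub>free_group S\<^esub> r = normal_closure (free_group S) R"
    using R assms by (intro group.coset_join2[OF group_free_group]) auto
  moreover have "word_value (presented_group S R) (generator S R) r =
      normal_closure (free_group S) R #>\<^bsub>free_group S\<^esub> r"
    using R assms by (intro word_value_generator) auto
  ultimately show ?thesis by (simp add: presented_group_def FactGroup_def)
qed

text \<open>
  Von Dyck's theorem: the kernel of the evaluation of words is normal and contains \<open>R\<close>, hence it
  contains the normal closure of \<open>R\<close>.\<close>

lemma presented_group_universal:
  assumes K: "group K" and f: "f \<in> S \<rightarrow> carrier K"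
    and rel: "\<And>r. r \<in> R \<Longrightarrow> word_value K f r = \<one>\<^bsub>K\<^esub>"
  obtains h where "h \<in> hom (presented_group S R) K" "\<And>x. x \<in> S \<Longrightarrow> h (generator S R x) = f x"
proof -
  have hom: "group_hom (free_group S) K (word_value K f)"
    using group_free_group K word_value_hom[OF K f] by (simp add: group_hom_def group_hom_axioms_def)
  have "R \<subseteq> kernel (free_group S) K (word_value K f)"
    using R rel by (auto simp: kernel_def)
  then have "normal_closure (free_group S) R \<subseteq> kernel (free_group S) K (word_value K f)"
    using group_hom.normal_kernel[OF hom] by (auto simp: normal_closure_def)
  then obtain h where h: "h \<in> hom (presented_group S R) K"
    "\<And>w. w \<in> carrier (free_group S) \<Longrightarrow>
      h (normal_closure (free_group S) R #>\<^bsub>free_group S\<^esub> w) = word_value K f w"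
    using group_hom.FactGroup_universal_kernel[OF hom normal_closure_relators]
    unfolding presented_group_def by blast
  show thesis
  proof (rule that[OF h(1)])
    fix x assume "x \<in> S"
    moreover from this have "f x \<in> carrier K" using f by auto
    ultimately show "h (generator S R x) = f x"
      using h(2)[of "[(x, True)]"] letter_closed K
      by (auto simp: generator_def Pi_iff group.is_monoid monoid.r_one)
  qed
qed

lemma presented_group_hom_eq:
  assumes K: "group K" and h: "h \<in> hom (presented_group S R) K" "h' \<in> hom (presented_group S R) K"
    and eq: "\<And>x. x \<in> S \<Longrightarrow> h (generator S R x) = h' (generator S R x)"
    and p: "p \<in> carrier (presented_group S R)"
  shows "h p = h' p"
proof -
  obtain w where w: "set w \<subseteq> S \<times> UNIV" "p = word_value (presented_group S R) (generator S R) w"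
    using presented_group_word[OF p] by metis
  have "h p = word_value K (h \<circ> generator S R) w"
    using hom_word_value[OF group_presented_group[OF R] K h(1) generator_closed w(1)] w by simp
  also have "\<dots> = word_value K (h' \<circ> generator S R) w"
    using eq by (intro word_value_cong[OF _ w(1)]) simp
  also have "\<dots> = h' p"
    using hom_word_value[OF group_presented_group[OF R] K h(2) generator_closed w(1)] w by simp
  finally show ?thesis .
qed

lemma presented_group_trivialI:
  assumes "\<And>x. x \<in> S \<Longrightarrow> generator S R x = \<one>\<^bsub>presented_group S R\<^esub>"
  shows "carrier (presented_group S R) = {\<one>\<^bsub>presented_group S R\<^esub>}"
proof -
  interpret P: group "presented_group S R" by (rule group_presented_group[OF R])
  have "p = \<one>\<^bsub>presented_group S R\<^esub>" if p: "p \<in> carrier (presented_group S R)" for p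
  proof -
    obtain w where w: "set w \<subseteq> S \<times> UNIV" "p = word_value (presented_group S R) (generator S R) w"
      using presented_group_word[OF p] by blast
    show ?thesis
      unfolding w(2) by (rule word_value_one[OF P.is_group _ w(1)]) (rule assms)
  qed
  then show ?thesis by auto
qed

end

section \<open>Rooted trees and their automorphisms\<close>

text \<open>
  A rooted tree is determined by its root \<open>r\<close> and the map \<open>p\<close> from each other vertex to its parent.
  The value \<open>p r\<close> is meaningless, hence the exclusion of \<open>r\<close> from both disjuncts.\<close>

definition parent_edges :: "'v set \<Rightarrow> 'v \<Rightarrow> ('v \<Rightarrow> 'v) \<Rightarrow> 'v rel" where
  "parent_edges V r p = {(x, y). x \<in> V \<and> y \<in> V \<and> (x \<noteq> r \<and> y = p x \<or> y \<noteq> r \<and> x = p y)}"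

text \<open>
  Following parents leads down to the root, so the graph is connected. It has no cycle, because both
  neighbours of a deepest vertex of a cycle would have to be its parent.\<close>

lemma tree_parent_edges:
  fixes depth :: "'v \<Rightarrow> nat"
  assumes r: "r \<in> V"
    and p: "\<And>x. x \<in> V \<Longrightarrow> x \<noteq> r \<Longrightarrow> p x \<in> V"
    and d: "\<And>x. x \<in> V \<Longrightarrow> x \<noteq> r \<Longrightarrow> depth x = Suc (depth (p x))"
  shows "tree V (parent_edges V r p)"
proof -
  define E where "E = parent_edges V r p"
  have edge: "x \<in> V \<and> y \<in> V \<and> (x \<noteq> r \<and> y = p x \<or> y \<noteq> r \<and> x = p y)" if "(x, y) \<in> E" for x y
    using that by (simp add: E_def parent_edges_def)
  have sym: "sym E" by (auto simp: E_def parent_edges_def sym_def)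
  have root: "(x, r) \<in> E\<^sup>*" if "x \<in> V" for x
    using that
  proof (induction "depth x" arbitrary: x rule: less_induct)
    case less
    show ?case
    proof (cases "x = r")
      case False
      then have "(x, p x) \<in> E" using less.prems p by (simp add: E_def parent_edges_def)
      moreover have "(p x, r) \<in> E\<^sup>*" using False less d p by simp
      ultimately show ?thesis by (rule converse_rtrancl_into_rtrancl)
    qed simp
  qed
  have conn: "(x, y) \<in> E\<^sup>*" if "x \<in> V" "y \<in> V" for x y
    using root[OF that(1)] root[OF that(2)] sym by (meson rtrancl_trans sym_rtrancl symE)
  have "\<not> cycle E c" for c
  proof
    assume "cycle E c"
    then have c: "length c \<ge> 3" "distinct c" "successively (\<lambda>x y. (x, y) \<in> E) c" "(last c, hd c) \<in> E"
      by (auto simp: cycle_def)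
    define n where "n = length c"
    have n: "n \<ge> 3" using c by (simp add: n_def)
    have "depth ` set c \<noteq> {}" using n n_def by auto
    then have "Max (depth ` set c) \<in> depth ` set c" by (intro Max_in) auto
    then obtain i where i: "i < n" "depth (c ! i) = Max (depth ` set c)"
      by (auto simp: in_set_conv_nth n_def)
    have mx: "depth (c ! j) \<le> depth (c ! i)" if "j < n" for j
      using that by (simp add: i n_def)
    have nb: "c ! j = p (c ! i)" if "j < n" "(c ! i, c ! j) \<in> E" for j
      using edge[OF that(2)] mx[OF that(1)] d by fastforce
    define j where "j = (if Suc i = n then 0 else Suc i)"
    define k where "k = (if i = 0 then n - 1 else i - 1)"
    have suc: "(c ! m, c ! Suc m) \<in> E" if "Suc m < n" for m
      using c(3) that by (simp add: successively_conv_nth n_def)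
    have wrap: "(c ! (n - 1), c ! 0) \<in> E"
      using c(1,4) by (cases "c = []") (auto simp: last_conv_nth hd_conv_nth n_def)
    have "(c ! i, c ! j) \<in> E"
      using suc[of i] wrap i(1) by (auto simp: j_def split: if_splits)
    moreover have "(c ! k, c ! i) \<in> E"
      using suc[of "i - 1"] wrap i(1) by (auto simp: k_def split: if_splits)
    then have "(c ! i, c ! k) \<in> E" using sym by (meson symE)
    moreover have "j < n" "k < n" "j \<noteq> k" using i n by (auto simp: j_def k_def)
    ultimately have "c ! j = c ! k" "c ! j \<noteq> c ! k"
      using nb[of j] nb[of k] c(2) by (simp_all add: n_def nth_eq_iff_index_eq)
    then show False by simp
  qed
  moreover have "irrefl E"
    using d by (fastforce simp: irrefl_def dest: edge)
  ultimately show ?thesis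
    unfolding tree_def E_def[symmetric] using r sym conn edge by auto
qed

text \<open>
  The colouring \<open>col\<close> excludes inversions: if adjacent vertices have different colours, no
  automorphism in this set can exchange them.\<close>

definition graph_automorphisms :: "'v set \<Rightarrow> 'v rel \<Rightarrow> ('v \<Rightarrow> bool) \<Rightarrow> ('v \<Rightarrow> 'v) set" where
  "graph_automorphisms V E col = {\<pi> \<in> Bij V.
     (\<forall>x\<in>V. \<forall>y\<in>V. (\<pi> x, \<pi> y) \<in> E \<longleftrightarrow> (x, y) \<in> E) \<and> (\<forall>x\<in>V. col (\<pi> x) \<longleftrightarrow> col x)}"

lemma subgroup_graph_automorphisms: "subgroup (graph_automorphisms V E col) (BijGroup V)"
proof -
  interpret B: group "BijGroup V" by (rule group_BijGroup)
  have cl: "\<pi> x \<in> V" if "\<pi> \<in> Bij V" "x \<in> V" for \<pi> x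
    using that by (meson Bij_imp_funcset funcset_mem)
  show ?thesis
  proof (rule B.subgroupI)
    show "graph_automorphisms V E col \<subseteq> carrier (BijGroup V)"
      by (auto simp: graph_automorphisms_def BijGroup_def)
    show "graph_automorphisms V E col \<noteq> {}"
      using id_Bij[of V] by (auto simp: graph_automorphisms_def)
  next
    fix \<pi> assume \<pi>: "\<pi> \<in> graph_automorphisms V E col"
    then have B: "\<pi> \<in> Bij V" by (simp add: graph_automorphisms_def)
    then have inv: "inv\<^bsub>BijGroup V\<^esub> \<pi> = (\<lambda>x\<in>V. inv_into V \<pi> x)" by (rule inv_BijGroup)
    have eq: "inv_into V \<pi> x \<in> V" "\<pi> (inv_into V \<pi> x) = x" if "x \<in> V" for x
      using that B by (auto simp: Bij_inv_into_mem Bij_def bij_betw_inv_into_right)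
    have e: "(inv_into V \<pi> x, inv_into V \<pi> y) \<in> E \<longleftrightarrow> (x, y) \<in> E" if "x \<in> V" "y \<in> V" for x y
      using \<pi> eq[OF that(1)] eq[OF that(2)] unfolding graph_automorphisms_def by force
    have "col (inv_into V \<pi> x) \<longleftrightarrow> col x" if "x \<in> V" for x
      using \<pi> eq[OF that] unfolding graph_automorphisms_def by force
    then show "inv\<^bsub>BijGroup V\<^esub> \<pi> \<in> graph_automorphisms V E col"
      unfolding inv using e restrict_inv_into_Bij[OF B] by (simp add: graph_automorphisms_def)
  next
    fix \<pi> \<rho> assume "\<pi> \<in> graph_automorphisms V E col" "\<rho> \<in> graph_automorphisms V E col"
    then show "\<pi> \<otimes>\<^bsub>BijGroup V\<^esub> \<rho> \<in> graph_automorphisms V E col"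
      using cl compose_Bij by (auto simp: graph_automorphisms_def BijGroup_def compose_eq)
  qed
qed

text \<open>
  An edge-preserving bijection of an infinite graph need not be an automorphism, so the inverse \<open>g\<close>
  has to preserve edges as well.\<close>

lemma graph_automorphismsI:
  assumes cl: "\<And>x. x \<in> V \<Longrightarrow> f x \<in> V" "\<And>x. x \<in> V \<Longrightarrow> g x \<in> V"
    and inv: "\<And>x. x \<in> V \<Longrightarrow> g (f x) = x" "\<And>x. x \<in> V \<Longrightarrow> f (g x) = x"
    and edge: "\<And>x y. (x, y) \<in> E \<Longrightarrow> x \<in> V \<Longrightarrow> y \<in> V \<Longrightarrow> (f x, f y) \<in> E"
      "\<And>x y. (x, y) \<in> E \<Longrightarrow> x \<in> V \<Longrightarrow> y \<in> V \<Longrightarrow> (g x, g y) \<in> E"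
    and col: "\<And>x. x \<in> V \<Longrightarrow> col (f x) \<longleftrightarrow> col x"
  shows "restrict f V \<in> graph_automorphisms V E col"
proof -
  have "bij_betw (restrict f V) V V"
    by (rule bij_betw_byWitness[where f' = g]) (use cl inv in auto)
  moreover have "(f x, f y) \<in> E \<longleftrightarrow> (x, y) \<in> E" if "x \<in> V" "y \<in> V" for x y
    using edge(1)[of x y] edge(2)[of "f x" "f y"] that cl(1) inv(1) by auto
  ultimately show ?thesis
    using col by (simp add: graph_automorphisms_def Bij_def)
qed

lemma restrict_pow_BijGroup:
  assumes "restrict f V \<in> Bij V"
  shows "restrict f V [^]\<^bsub>BijGroup V\<^esub> n = restrict (f ^^ n) V"
proof (induction n)
  case 0
  then show ?case by (simp add: BijGroup_def)
next
  case (Suc n)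
  interpret B: group "BijGroup V" by (rule group_BijGroup)
  have c: "restrict f V \<in> carrier (BijGroup V)" using assms by (simp add: BijGroup_def)
  then have "restrict (f ^^ n) V \<in> Bij V"
    using B.nat_pow_closed[OF c, of n] unfolding Suc by (simp add: BijGroup_def)
  then have "restrict f V [^]\<^bsub>BijGroup V\<^esub> Suc n = compose V (restrict (f ^^ n) V) (restrict f V)"
    using assms unfolding B.nat_pow_Suc Suc by (simp add: BijGroup_def)
  also have "\<dots> = restrict (f ^^ Suc n) V"
    using Bij_imp_funcset[OF assms] by (auto simp: compose_def fun_eq_iff funpow_swap1 Pi_iff)
  finally show ?case .
qed

lemma tree_actionI:
  assumes P: "group P" and T: "tree V E" and h: "h \<in> hom P (BijGroup V)"
    and aut: "h ` carrier P \<subseteq> graph_automorphisms V E col"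
    and col: "\<And>x y. (x, y) \<in> E \<Longrightarrow> col x \<noteq> col y"
  shows "tree_action P V E h"
  unfolding tree_action_def
proof (intro conjI ballI)
  show "group_action P V h"
    using P h group_BijGroup by (simp add: group_action_def group_hom_def group_hom_axioms_def)
  fix g e assume g: "g \<in> carrier P" and e: "e \<in> E"
  then obtain x y where xy: "e = (x, y)" "x \<in> V" "y \<in> V"
    using T by (auto simp: tree_def)
  have "h g \<in> graph_automorphisms V E col" using aut g by auto
  then show "case e of (x, y) \<Rightarrow> (h g x, h g y) \<in> E \<and> \<not> (h g x = y \<and> h g y = x)"
    using xy e col[of x y] by (auto simp: graph_automorphisms_def)
qed (rule T)


section \<open>The tree of a free product with a cyclic group\<close>

text \<open>
  The recursion runs from the front of the list, where \<open>G\<close> and \<open>C\<close> act, although only the last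
  entry changes.\<close>

primrec parent :: "('a \<times> nat) list \<Rightarrow> ('a \<times> nat) list" where
  "parent [] = []"
| "parent (a # w) =
    (if w = [] then if snd a = 0 then [] else [(fst a, 0)] else a # parent w)"

primrec height :: "('a \<times> nat) list \<Rightarrow> nat" where
  "height [] = 0"
| "height (a # w) = (if w = [] \<and> snd a = 0 then 1 else Suc (Suc (height w)))"

lemma hd_parent: "parent w \<noteq> [] \<Longrightarrow> fst (hd (parent w)) = fst (hd w)"
  by (cases w) (auto split: if_splits)

text \<open>
  The Bass--Serre tree of \<open>G * C\<close>, where \<open>C\<close> is cyclic of order \<open>k\<close> with generator \<open>s\<close>. Its vertices
  are the cosets of \<open>G\<close> and of \<open>C\<close>. They are coded by their normal forms: the list
  \<open>[(g\<^sub>0, c\<^sub>0), \<dots>, (g\<^sub>n, c\<^sub>n)]\<close> with last exponent \<open>c\<^sub>n \<noteq> 0\<close> stands for the coset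
  \<open>g\<^sub>0 s^c\<^sub>0 \<dots> g\<^sub>n s^c\<^sub>n G\<close>, with last exponent \<open>c\<^sub>n = 0\<close> for the coset
  \<open>g\<^sub>0 s^c\<^sub>0 \<dots> g\<^sub>n C\<close>, and the empty list for \<open>G\<close> itself. So exponents lie below \<open>k\<close> and only the last
  one may vanish, and only the first group element \<open>g\<^sub>0\<close> may be \<open>\<one>\<close>. The parent of
  a vertex arises by dropping the last nontrivial power of \<open>s\<close> or the last group element, and cosets
  of \<open>G\<close> and of \<open>C\<close> are told apart by the parity of the height.\<close>

locale cyclic_free_product = group G for G (structure) +
  fixes k :: nat
  assumes k: "2 \<le> k"
begin

primrec is_vertex :: "('a \<times> nat) list \<Rightarrow> bool" where
  "is_vertex [] \<longleftrightarrow> True"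
| "is_vertex (a # w) \<longleftrightarrow> fst a \<in> carrier G \<and> snd a < k \<and>
    (w \<noteq> [] \<longrightarrow> snd a \<noteq> 0 \<and> fst (hd w) \<noteq> \<one>) \<and> is_vertex w"

abbreviation V :: "('a \<times> nat) list set" where "V \<equiv> Collect is_vertex"

definition E :: "('a \<times> nat) list rel" where "E = parent_edges V [] parent"

lemma is_vertex_parent: "is_vertex w \<Longrightarrow> is_vertex (parent w)"
  by (induction w) (use k in \<open>auto simp: hd_parent\<close>)

lemma height_parent: "is_vertex w \<Longrightarrow> w \<noteq> [] \<Longrightarrow> height w = Suc (height (parent w))"
  by (induction w) auto

lemma is_tree: "tree V E"
  unfolding E_def
  by (rule tree_parent_edges[where depth = height]) (simp_all add: is_vertex_parent height_parent)

lemma edge_parity: "(v, w) \<in> E \<Longrightarrow> even (height v) \<noteq> even (height w)"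
  by (auto simp: E_def parent_edges_def height_parent)

text \<open>
  The second alternative is needed because \<open>spin\<close> moves the root, and therefore turns around the
  edges on the path from the root to the vertex that is moved to the root.\<close>

lemma preserves_edges:
  assumes cl: "\<And>w. is_vertex w \<Longrightarrow> is_vertex (f w)"
    and par: "\<And>w. is_vertex w \<Longrightarrow> w \<noteq> [] \<Longrightarrow>
      f w \<noteq> [] \<and> f (parent w) = parent (f w) \<or> f (parent w) \<noteq> [] \<and> f w = parent (f (parent w))"
    and e: "(v, w) \<in> E"
  shows "(f v, f w) \<in> E"
  using e par[of v] par[of w] cl[of v] cl[of w] unfolding E_def parent_edges_def by auto

definition translate :: "'a \<Rightarrow> ('a \<times> nat) list \<Rightarrow> ('a \<times> nat) list" where
  "translate g w = (case w of [] \<Rightarrow> [] | a # u \<Rightarrow> (g \<otimes> fst a, snd a) # u)"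

text \<open>
  Left multiplication by \<open>s\<close>, carried out on normal forms. It fixes the vertex \<open>[(\<one>, 0)]\<close>, that is
  the coset \<open>C\<close>, and rotates the \<open>k\<close> branches at this vertex.\<close>

definition spin :: "('a \<times> nat) list \<Rightarrow> ('a \<times> nat) list" where
  "spin w = (case w of [] \<Rightarrow> [(\<one>, 1)]
     | a # u \<Rightarrow> if fst a \<noteq> \<one> then (\<one>, 1) # w else if snd a = 0 then w
       else if Suc (snd a) < k then (\<one>, Suc (snd a)) # u else u)"

lemma translate_vertex: "g \<in> carrier G \<Longrightarrow> is_vertex w \<Longrightarrow> is_vertex (translate g w)"
  by (cases w) (auto simp: translate_def)

lemma translate_one: "is_vertex w \<Longrightarrow> translate \<one> w = w"
  by (cases w) (auto simp: translate_def)

lemma translate_mult: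
  "g \<in> carrier G \<Longrightarrow> h \<in> carrier G \<Longrightarrow> is_vertex w \<Longrightarrow>
    translate (g \<otimes> h) w = translate g (translate h w)"
  by (cases w) (auto simp: translate_def m_assoc)

lemma translate_edge:
  assumes "g \<in> carrier G" "(v, w) \<in> E"
  shows "(translate g v, translate g w) \<in> E"
  by (rule preserves_edges[where f = "translate g", OF _ _ assms(2)])
    (use assms(1) in \<open>auto simp: translate_vertex, auto simp: translate_def split: list.splits\<close>)

lemma translate_parity: "even (height (translate g w)) = even (height w)"
  by (simp add: translate_def split: list.splits)

lemma translate_automorphism:
  assumes "g \<in> carrier G"
  shows "restrict (translate g) V \<in> graph_automorphisms V E (\<lambda>w. even (height w))"
  using assms
  by (intro graph_automorphismsI[where g = "translate (inv g)"])
    (auto simp: translate_vertex translate_edge translate_parity translate_one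
      simp flip: translate_mult)

lemma translate_hom: "(\<lambda>g. restrict (translate g) V) \<in> hom G (BijGroup V)"
proof -
  have "group_action G V (\<lambda>g. restrict (translate g) V)"
    by (rule group_actionI) (simp_all add: is_group translate_vertex translate_one translate_mult)
  then show ?thesis by (simp add: group_action_def group_hom_def group_hom_axioms_def)
qed

lemma spin_vertex: "is_vertex w \<Longrightarrow> is_vertex (spin w)"
  using k by (cases w) (auto simp: spin_def)

lemma spin_parity: "is_vertex w \<Longrightarrow> even (height (spin w)) = even (height w)"
  using k by (cases w) (auto simp: spin_def)

lemma spin_edge:
  assumes "(v, w) \<in> E"
  shows "(spin v, spin w) \<in> E"
proof (rule preserves_edges[where f = spin, OF _ _ assms])
  fix w assume "is_vertex w" "w \<noteq> []"
  then show "spin w \<noteq> [] \<and> spin (parent w) = parent (spin w) \<or>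
      spin (parent w) \<noteq> [] \<and> spin w = parent (spin (parent w))"
    using k by (cases w) (auto simp: spin_def hd_parent split: list.splits if_splits)
qed (rule spin_vertex)

text \<open>
  Here \<open>w\<close> is the normal form of a vertex in the branch of the root; \<open>s\<^sup>j\<close> carries this
  branch to the \<open>j\<close>-th one.\<close>

lemma spin_pow_free:
  assumes "w = [] \<or> fst (hd w) \<noteq> \<one>" "0 < j" "j < k"
  shows "(spin ^^ j) w = (\<one>, j) # w"
  using assms(2,3)
proof (induction j)
  case (Suc j)
  show ?case
  proof (cases "j = 0")
    case True
    then show ?thesis using assms(1) by (cases w) (auto simp: spin_def)
  next
    case False
    then show ?thesis using Suc by (simp add: spin_def)
  qed
qed simp

lemma spin_pow: "is_vertex w \<Longrightarrow> (spin ^^ k) w = w"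
proof -
  have free: "(spin ^^ k) w = w" if "w = [] \<or> fst (hd w) \<noteq> \<one>" for w
  proof -
    have "k = Suc (k - 1)" using k by simp
    then have "(spin ^^ k) w = spin ((spin ^^ (k - 1)) w)" by (metis comp_apply funpow.simps(2))
    then show ?thesis using spin_pow_free[OF that, of "k - 1"] k by (simp add: spin_def)
  qed
  assume w: "is_vertex w"
  show ?thesis
  proof (cases "w = [] \<or> fst (hd w) \<noteq> \<one>")
    case False
    then obtain c u where wc: "w = (\<one>, c) # u" by (cases w) auto
    show ?thesis
    proof (cases "c = 0")
      case True
      have "(spin ^^ n) w = w" for n
        by (induction n) (use w wc True in \<open>auto simp: spin_def\<close>)
      then show ?thesis .
    next
      case False
      \<comment> \<open>rotating \<open>w\<close> back by \<open>c\<close> branches reduces to the branch of the root\<close>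
      have u: "u = [] \<or> fst (hd u) \<noteq> \<one>" "c < k" using w wc by auto
      then have "w = (spin ^^ c) u" using spin_pow_free[of u c] False wc by simp
      then have "(spin ^^ k) w = (spin ^^ c) ((spin ^^ k) u)"
        by (simp add: add.commute flip: funpow_add[THEN fun_cong, unfolded comp_apply])
      then show ?thesis using free[OF u(1)] \<open>w = (spin ^^ c) u\<close> by simp
    qed
  qed (rule free)
qed

lemma spin_pow_vertex: "is_vertex w \<Longrightarrow> is_vertex ((spin ^^ n) w)"
  by (induction n) (auto simp: spin_vertex)

lemma spin_pow_edge: "(v, w) \<in> E \<Longrightarrow> ((spin ^^ n) v, (spin ^^ n) w) \<in> E"
  by (induction n) (auto simp: spin_edge)

lemma spin_automorphism: "restrict spin V \<in> graph_automorphisms V E (\<lambda>w. even (height w))"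
proof (rule graph_automorphismsI[where g = "spin ^^ (k - 1)"])
  have Suc: "Suc (k - 1) = k" using k by simp
  fix w assume w: "w \<in> V"
  have "(spin ^^ (k - 1)) (spin w) = (spin ^^ Suc (k - 1)) w"
    by (simp only: funpow_Suc_right comp_apply)
  then show "(spin ^^ (k - 1)) (spin w) = w" using w Suc spin_pow by simp
  have "spin ((spin ^^ (k - 1)) w) = (spin ^^ Suc (k - 1)) w" by simp
  then show "spin ((spin ^^ (k - 1)) w) = w" using w Suc spin_pow by simp
qed (simp_all add: spin_vertex spin_pow_vertex spin_edge spin_pow_edge spin_parity)

lemma spin_fixed_point: "is_vertex w \<Longrightarrow> spin w = w \<Longrightarrow> w = [(\<one>, 0)]"
  by (cases w) (auto simp: spin_def split: if_splits)

text \<open>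
  The rotation fixes a single vertex, and the stabilizer of this vertex in \<open>G\<close> is trivial.\<close>

lemma translate_spin_no_fixed_point:
  assumes "g \<in> carrier G" "g \<noteq> \<one>" "is_vertex w" "spin w = w"
  shows "translate g w \<noteq> w"
  using spin_fixed_point[OF assms(3,4)] assms(1,2) by (simp add: translate_def)

end

section \<open>Property (FA) and homomorphisms\<close>

lemma property_FA_epi:
  fixes K :: "('k, 'm) monoid_scheme"
  assumes G: "group G" and K: "group K" and h: "h \<in> epi G K" and FA: "property_FA G"
  shows "property_FA K"
  unfolding property_FA_def
proof (intro allI impI)
  fix V :: "'k list set" and E \<phi>
  assume act: "tree_action K V E \<phi>"
  have hom: "h \<in> hom G K" "h ` carrier G = carrier K" using h by (auto simp: epi_def)
  have "\<phi> \<in> hom K (BijGroup V)"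
    using act by (simp add: tree_action_def group_action_def group_hom_def group_hom_axioms_def)
  then have "\<phi> \<circ> h \<in> hom G (BijGroup V)" using hom by (intro hom_compose)
  then have "group_action G V (\<phi> \<circ> h)"
    using G group_BijGroup by (simp add: group_action_def group_hom_def group_hom_axioms_def)
  then have "tree_action G V E (\<phi> \<circ> h)"
    using act hom by (fastforce simp: tree_action_def)
  then have "has_fixed_point G V (\<phi> \<circ> h)" by (rule property_FA_fixed_point[OF FA])
  then show "has_fixed_point K V \<phi>"
    by (simp add: has_fixed_point_def flip: hom(2))
qed

lemma property_FA_iso:
  assumes "group G" "group K" "G \<cong> K" "property_FA G"
  shows "property_FA K"
proof -
  obtain h where "h \<in> epi G K" using assms(3) by (auto simp: is_iso_def iso_iff_mon_epi)
  then show ?thesis using property_FA_epi assms(1,2,4) by blast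
qed

section \<open>Replacing a relator by a square root and a cube root\<close>

text \<open>
  The relation \<open>x\<^sup>k = r\<close>, written as a reduced word.\<close>

definition power_relator :: "'x set \<Rightarrow> 'x \<Rightarrow> nat \<Rightarrow> 'x word \<Rightarrow> 'x word" where
  "power_relator S x k r =
     [(x, True)] [^]\<^bsub>free_group S\<^esub> k \<otimes>\<^bsub>free_group S\<^esub> inv\<^bsub>free_group S\<^esub> r"

lemma carrier_free_group_mono: "S \<subseteq> T \<Longrightarrow> carrier (free_group S) \<subseteq> carrier (free_group T)"
  by (auto simp: free_group_def)

lemma letter_in_free_group: "x \<in> S \<Longrightarrow> [(x, b)] \<in> carrier (free_group S)"
  by (simp add: free_group_def reduced_def)

lemma power_relator_closed:
  assumes "x \<in> S" "r \<in> carrier (free_group S)"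
  shows "power_relator S x k r \<in> carrier (free_group S)"
proof -
  interpret group "free_group S" by (rule group_free_group)
  show ?thesis using assms by (simp add: power_relator_def letter_in_free_group)
qed

lemma word_value_power_relator:
  assumes K: "group K" and f: "f \<in> S \<rightarrow> carrier K"
    and r: "x \<in> S" "r \<in> carrier (free_group S)"
  shows "word_value K f (power_relator S x k r) =
    f x [^]\<^bsub>K\<^esub> k \<otimes>\<^bsub>K\<^esub> inv\<^bsub>K\<^esub> word_value K f r"
proof -
  interpret group_hom "free_group S" K "word_value K f"
    using group_free_group K word_value_hom[OF K f] by (simp add: group_hom_def group_hom_axioms_def)
  have "f x \<in> carrier K" using f r by auto
  then show ?thesis
    using r by (simp add: power_relator_def letter_in_free_group hom_nat_pow)
qed

lemma (in group) eq_one_if_square_eq_cube: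
  assumes "x \<in> carrier G" "y \<in> carrier G"
    and "x [^] (2::nat) = y" "x [^] (3::nat) = y"
  shows "y = \<one>" "x = \<one>"
proof -
  have "y \<otimes> x = y" using assms by (simp add: numeral_3_eq_3 numeral_2_eq_2)
  then show "x = \<one>" using assms by simp
  then show "y = \<one>" using assms by (metis nat_pow_one)
qed

locale root_adjunction =
  fixes S :: "'x set" and R :: "'x word set" and t :: "'x word \<Rightarrow> 'x"
  assumes R: "R \<subseteq> carrier (free_group S)"
    and inj: "inj_on t R" and new: "t ` R \<inter> S = {}"
begin

definition gens :: "'x set" where "gens = S \<union> t ` R"

definition rels :: "'x word set" where
  "rels = (\<Union>r\<in>R. {power_relator gens (t r) 2 r, power_relator gens (t r) 3 r})"

lemma R_gens: "R \<subseteq> carrier (free_group gens)"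
  using R carrier_free_group_mono[of S gens] by (auto simp: gens_def)

lemma rels_closed: "rels \<subseteq> carrier (free_group gens)"
  using R_gens by (auto simp: rels_def gens_def intro!: power_relator_closed)

lemma relator_letters: "r \<in> R \<Longrightarrow> set r \<subseteq> S \<times> UNIV"
  using R by (auto simp: free_group_def)

lemma extend_closed:
  assumes "f \<in> S \<rightarrow> A" "u \<in> t ` R \<rightarrow> A"
  shows "(\<lambda>x. if x \<in> S then f x else u x) \<in> gens \<rightarrow> A"
  using assms by (auto simp: gens_def Pi_iff)

lemma word_value_power_relator_extend:
  assumes K: "group K" and f: "f \<in> S \<rightarrow> carrier K" and u: "u \<in> t ` R \<rightarrow> carrier K"
    and r: "r \<in> R" and one: "word_value K f r = \<one>\<^bsub>K\<^esub>"
  shows "word_value K (\<lambda>x. if x \<in> S then f x else u x) (power_relator gens (t r) k r) =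
    u (t r) [^]\<^bsub>K\<^esub> k"
proof -
  interpret group K by fact
  let ?f = "\<lambda>x. if x \<in> S then f x else u x"
  have f': "?f \<in> gens \<rightarrow> carrier K" using f u by (rule extend_closed)
  have "word_value K ?f r = word_value K f r"
    by (rule word_value_cong[OF _ relator_letters[OF r]]) simp
  moreover have "?f (t r) = u (t r)" "u (t r) \<in> carrier K" using new r u by auto
  ultimately show ?thesis
    using word_value_power_relator[OF K f', of "t r" r k] R_gens r one by (auto simp: gens_def)
qed

text \<open>
  From \<open>t\<^sub>r\<^sup>2 = r = t\<^sub>r\<^sup>3\<close> one gets \<open>t\<^sub>r = 1\<close>, and then \<open>r = 1\<close>.\<close>

lemma relator_one:
  assumes "r \<in> R"
  shows "word_value (presented_group gens rels) (generator gens rels) r = \<one>\<^bsub>presented_group gens rels\<^esub>"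
    and "generator gens rels (t r) = \<one>\<^bsub>presented_group gens rels\<^esub>"
proof -
  let ?P = "presented_group gens rels" and ?g = "generator gens rels"
  interpret P: group ?P by (rule group_presented_group[OF rels_closed])
  have t: "t r \<in> gens" and rc: "r \<in> carrier (free_group gens)"
    using assms R_gens by (auto simp: gens_def)
  have c: "?g \<in> gens \<rightarrow> carrier ?P" by (rule generator_closed[OF rels_closed])
  have v: "word_value ?P ?g r \<in> carrier ?P" "?g (t r) \<in> carrier ?P"
    using word_value_closed[OF P.is_group c] rc c t by (auto simp: free_group_def)
  have "?g (t r) [^]\<^bsub>?P\<^esub> k = word_value ?P ?g r" if "power_relator gens (t r) k r \<in> rels" for k
  proof -
    have "?g (t r) [^]\<^bsub>?P\<^esub> k \<otimes>\<^bsub>?P\<^esub> inv\<^bsub>?P\<^esub> word_value ?P ?g r = \<one>\<^bsub>?P\<^esub>"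
      using word_value_relator[OF rels_closed that]
        word_value_power_relator[OF P.is_group c, of "t r" r k] t rc by simp
    then show ?thesis using v P.right_cancel P.r_inv P.inv_closed P.nat_pow_closed by metis
  qed
  then have "?g (t r) [^]\<^bsub>?P\<^esub> (2::nat) = word_value ?P ?g r"
      "?g (t r) [^]\<^bsub>?P\<^esub> (3::nat) = word_value ?P ?g r"
    using assms by (auto simp: rels_def)
  then show "word_value ?P ?g r = \<one>\<^bsub>?P\<^esub>" "?g (t r) = \<one>\<^bsub>?P\<^esub>"
    using P.eq_one_if_square_eq_cube v by blast+
qed

text \<open>
  Killing every \<open>t\<^sub>r\<close> is inverse to the map induced by the inclusion of \<open>S\<close> into the new generators,
  which is well defined because the old relators hold in the new group.\<close>

lemma presented_group_iso: "presented_group gens rels \<cong> presented_group S R"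
proof -
  let ?P = "presented_group gens rels" and ?g = "generator gens rels"
  let ?Q = "presented_group S R" and ?q = "generator S R"
  interpret P: group ?P by (rule group_presented_group[OF rels_closed])
  interpret Q: group ?Q by (rule group_presented_group[OF R])
  have gc: "?g \<in> gens \<rightarrow> carrier ?P" by (rule generator_closed[OF rels_closed])
  have qc: "?q \<in> S \<rightarrow> carrier ?Q" by (rule generator_closed[OF R])
  let ?f = "\<lambda>x. if x \<in> S then ?q x else \<one>\<^bsub>?Q\<^esub>"
  have fc: "?f \<in> gens \<rightarrow> carrier ?Q" using qc by (intro extend_closed) auto
  have "word_value ?Q ?f (power_relator gens (t r) k r) = \<one>\<^bsub>?Q\<^esub>" if "r \<in> R" for k r
    using word_value_power_relator_extend[OF Q.is_group qc _ that, of "\<lambda>_. \<one>\<^bsub>?Q\<^esub>"]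
      word_value_relator[OF R that] by simp
  then have rels: "word_value ?Q ?f s = \<one>\<^bsub>?Q\<^esub>" if "s \<in> rels" for s
    using that by (auto simp: rels_def)
  obtain h where h: "h \<in> hom ?P ?Q" "\<And>x. x \<in> gens \<Longrightarrow> h (?g x) = ?f x"
    using presented_group_universal[OF rels_closed Q.is_group fc] rels by blast
  have "?g \<in> S \<rightarrow> carrier ?P" using gc by (auto simp: gens_def)
  then obtain h' where h': "h' \<in> hom ?Q ?P" "\<And>x. x \<in> S \<Longrightarrow> h' (?q x) = ?g x"
    using presented_group_universal[OF R P.is_group] relator_one(1) by metis
  have "h' (h p) = p" if "p \<in> carrier ?P" for p
  proof -
    have "(h' \<circ> h) p = id p"
    proof (rule presented_group_hom_eq[OF rels_closed P.is_group _ _ _ that])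
      show "h' \<circ> h \<in> hom ?P ?P" using h(1) h'(1) by (rule hom_compose)
      show "id \<in> hom ?P ?P" by (simp add: hom_def)
      fix x assume "x \<in> gens"
      then show "(h' \<circ> h) (?g x) = id (?g x)"
        using h(2) h'(2) relator_one(2) new hom_one[OF h'(1) Q.is_group P.is_group]
        by (auto simp: gens_def)
    qed
    then show ?thesis by simp
  qed
  moreover have "h (h' q) = q" if "q \<in> carrier ?Q" for q
  proof -
    have "(h \<circ> h') q = id q"
    proof (rule presented_group_hom_eq[OF R Q.is_group _ _ _ that])
      show "h \<circ> h' \<in> hom ?Q ?Q" using h'(1) h(1) by (rule hom_compose)
      show "id \<in> hom ?Q ?Q" by (simp add: hom_def)
      fix x assume "x \<in> S"
      then show "(h \<circ> h') (?q x) = id (?q x)" using h(2) h'(2) by (simp add: gens_def)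
    qed
    then show ?thesis by simp
  qed
  ultimately have "group_isomorphisms ?P ?Q h h'"
    using h(1) h'(1) by (simp add: group_isomorphisms_def)
  then show ?thesis by (intro is_isoI group_isomorphisms_imp_iso)
qed

text \<open>
  The presented group acts on the tree of \<open>\<langle>S | R\<rangle> * \<int>/j\<close>: the old generators through
  \<open>\<langle>S | R\<rangle>\<close>, the letter \<open>t\<^sub>r\<close> by rotation, the other new letters trivially. Two of the new relators
  might be equal as words, which does no harm: removing the word \<open>t\<^sub>r\<^sup>i = r\<close> then removes both, and
  only the relators that remain have to hold.\<close>

lemma not_property_FA_remove:
  assumes r: "r \<in> R" and ij: "{i, j} = {2, 3 :: nat}"
    and nt: "carrier (presented_group S R) \<noteq> {\<one>\<^bsub>presented_group S R\<^esub>}"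
  shows "\<not> property_FA (presented_group gens (rels - {power_relator gens (t r) i r}))"
proof
  let ?R = "rels - {power_relator gens (t r) i r}"
  let ?P = "presented_group gens ?R" and ?g = "generator gens ?R"
  let ?Q = "presented_group S R" and ?q = "generator S R"
  assume FA: "property_FA ?P"
  have Rc: "?R \<subseteq> carrier (free_group gens)" using rels_closed by blast
  interpret P: group ?P by (rule group_presented_group[OF Rc])
  interpret Q: group ?Q by (rule group_presented_group[OF R])
  have j: "2 \<le> j" using ij by (auto simp: doubleton_eq_iff)
  interpret T: cyclic_free_product ?Q j by unfold_locales (rule j)
  let ?A = "graph_automorphisms T.V T.E (\<lambda>w. even (height w))"
  let ?B = "BijGroup T.V"
  interpret B: group ?B by (rule group_BijGroup)
  have AB: "?A \<subseteq> carrier ?B" using subgroup_graph_automorphisms by (rule subgroup.subset)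
  have qc: "?q \<in> S \<rightarrow> carrier ?Q" by (rule generator_closed[OF R])
  define l where "l x = restrict (T.translate (?q x)) T.V" for x
  define u where "u x = (if x = t r then restrict T.spin T.V else \<one>\<^bsub>?B\<^esub>)" for x
  define f where "f = (\<lambda>x. if x \<in> S then l x else u x)"
  have lA: "l \<in> S \<rightarrow> ?A" using qc T.translate_automorphism by (auto simp: l_def dest!: funcset_mem)
  have uA: "u \<in> t ` R \<rightarrow> ?A"
    using T.spin_automorphism subgroup.one_closed[OF subgroup_graph_automorphisms]
    by (auto simp: u_def)
  have fA: "f \<in> gens \<rightarrow> ?A" unfolding f_def using lA uA by (rule extend_closed)
  have l_one: "word_value ?B l r' = \<one>\<^bsub>?B\<^esub>" if "r' \<in> R" for r'
    using hom_word_value[OF Q.is_group B.is_group T.translate_hom qc relator_letters[OF that]]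
      word_value_relator[OF R that] hom_one[OF T.translate_hom Q.is_group B.is_group]
    by (simp add: l_def[abs_def] comp_def)
  have spin: "restrict T.spin T.V [^]\<^bsub>?B\<^esub> j = \<one>\<^bsub>?B\<^esub>"
  proof -
    have "restrict T.spin T.V \<in> Bij T.V"
      using T.spin_automorphism by (simp add: graph_automorphisms_def)
    then have "restrict T.spin T.V [^]\<^bsub>?B\<^esub> j = restrict (T.spin ^^ j) T.V"
      by (rule restrict_pow_BijGroup)
    also have "\<dots> = \<one>\<^bsub>?B\<^esub>" by (auto simp: BijGroup_def T.spin_pow)
    finally show ?thesis .
  qed
  have rel: "word_value ?B f s = \<one>\<^bsub>?B\<^esub>" if s: "s \<in> ?R" for s
  proof -
    obtain r' n where rn: "r' \<in> R" "s = power_relator gens (t r') n r'" "n \<in> {2, 3}"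
      using s by (auto simp: rels_def)
    have "word_value ?B f s = u (t r') [^]\<^bsub>?B\<^esub> n"
      unfolding f_def rn(2)
      using lA uA AB by (intro word_value_power_relator_extend B.is_group rn(1) l_one) auto
    also have "\<dots> = \<one>\<^bsub>?B\<^esub>"
    proof (cases "r' = r")
      case True
      then have "n = j" using s rn ij by auto
      then show ?thesis using True spin by (simp add: u_def)
    next
      case False
      then have "u (t r') = \<one>\<^bsub>?B\<^esub>" using inj r rn(1) by (auto simp: u_def inj_on_def)
      then show ?thesis by simp
    qed
    finally show ?thesis .
  qed
  have fB: "f \<in> gens \<rightarrow> carrier ?B" using fA AB by auto
  obtain h where h: "h \<in> hom ?P ?B" "\<And>x. x \<in> gens \<Longrightarrow> h (?g x) = f x"
    using presented_group_universal[OF Rc B.is_group fB rel] by blast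
  have gc: "?g \<in> gens \<rightarrow> carrier ?P" by (rule generator_closed[OF Rc])
  have "h p \<in> ?A" if "p \<in> carrier ?P" for p
  proof -
    obtain w where w: "set w \<subseteq> gens \<times> UNIV" "p = word_value ?P ?g w"
      using presented_group_word[OF Rc \<open>p \<in> carrier ?P\<close>] by blast
    have "h p = word_value ?B (h \<circ> ?g) w"
      unfolding w(2) by (rule hom_word_value[OF P.is_group B.is_group h(1) gc w(1)])
    moreover have "h \<circ> ?g \<in> gens \<rightarrow> ?A" using h(2) fA by auto
    ultimately show ?thesis
      using word_value_in_subgroup[OF B.is_group subgroup_graph_automorphisms _ w(1)] by metis
  qed
  \<comment> \<open>each generator acts by a colour-preserving automorphism, hence so does each element\<close>
  then have "tree_action ?P T.V T.E h"
    by (intro tree_actionI P.is_group T.is_tree h(1)) (auto dest: T.edge_parity)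
  then have "has_fixed_point ?P T.V h" by (rule property_FA_fixed_point[OF FA])
  then obtain v where v: "T.is_vertex v" "\<And>p. p \<in> carrier ?P \<Longrightarrow> h p v = v"
    by (auto simp: has_fixed_point_def)
  have fv: "f x v = v" if "x \<in> gens" for x
    using v(2)[of "?g x"] gc h(2)[OF that] that by auto
  have "t r \<in> gens" "t r \<notin> S" using r new by (auto simp: gens_def)
  then have spin_v: "T.spin v = v" using fv[of "t r"] v(1) by (simp add: f_def u_def)
  obtain x where x: "x \<in> S" "?q x \<noteq> \<one>\<^bsub>?Q\<^esub>" using presented_group_trivialI[OF R] nt by blast
  then have "T.translate (?q x) v = v"
    using fv[of x] v(1) by (simp add: f_def l_def gens_def)
  moreover have "?q x \<in> carrier ?Q" using x(1) qc by auto
  ultimately show False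
    using T.translate_spin_no_fixed_point x(2) v(1) spin_v by blast
qed

end

section \<open>Existence of just-(FA) presentations\<close>

theorem theorem2:
  fixes G :: "('g, 'm) monoid_scheme"
  assumes "group G"
    and "finitely_presented G"
    and "property_FA G"
  shows "\<exists>(S :: nat set) R. finite S \<and> finite R \<and> presents S R G \<and> just_FA S R"
proof -
  obtain S :: "nat set" and R where SR: "finite S" "finite R" "R \<subseteq> carrier (free_group S)"
    "presented_group S R \<cong> G"
    using assms(2) by (auto simp: finitely_presented_def presents_def)
  interpret Q: group "presented_group S R" by (rule group_presented_group[OF SR(3)])
  have FA: "property_FA K" if "group K" "K \<cong> G" for K :: "nat word set monoid"
    using property_FA_iso[OF assms(1) that(1) group.iso_sym[OF that] assms(3)] .
  show ?thesis
  proof (cases "carrier (presented_group S R) = {\<one>\<^bsub>presented_group S R\<^esub>}")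
    case True
    \<comment> \<open>with no relators there is none to remove\<close>
    let ?T = "presented_group ({} :: nat set) {}"
    interpret T: group ?T by (rule group_presented_group) simp
    have "carrier ?T = {\<one>\<^bsub>?T\<^esub>}" by (rule presented_group_trivialI) auto
    then have "?T \<cong> presented_group S R"
      using True
      by (intro is_isoI[of "\<lambda>_. \<one>\<^bsub>presented_group S R\<^esub>"] isoI) (auto simp: hom_def bij_betw_def)
    also note SR(4)
    finally have "?T \<cong> G" .
    then have "presents ({} :: nat set) {} G" "just_FA ({} :: nat set) {}"
      using FA[OF T.is_group] by (auto simp: presents_def just_FA_def)
    then show ?thesis by blast
  next
    case False
    \<comment> \<open>the new generators are natural numbers outside \<open>S\<close>, one for each relator\<close>
    have "infinite (- S)" using SR(1) by (simp add: finite_compl)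
    then obtain T where T: "T \<subseteq> - S" "finite T" "card T = card R"
      using infinite_arbitrarily_large by metis
    then obtain t where t: "bij_betw t R T"
      using SR(2) finite_same_card_bij by metis
    interpret root_adjunction S R t
      using SR(3) t T(1) by unfold_locales (auto simp: bij_betw_def)
    have iso: "presented_group gens rels \<cong> G"
      using presented_group_iso SR(4) by (rule iso_trans)
    have "\<not> property_FA (presented_group gens (rels - {s}))" if s: "s \<in> rels" for s
      using s not_property_FA_remove[OF _ _ False, of _ 2 3] not_property_FA_remove[OF _ _ False, of _ 3 2]
      by (auto simp: rels_def)
    then have "just_FA gens rels"
      using rels_closed FA[OF group_presented_group[OF rels_closed] iso] by (simp add: just_FA_def)
    moreover have "presents gens rels G" using rels_closed iso by (simp add: presents_def)
    moreover have "finite gens" "finite rels" using SR(1,2) by (auto simp: gens_def rels_def)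
    ultimately show ?thesis by blast
  qed
qed

end
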